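(* Let $d\ge1$, let $\boldsymbol{\gamma}=(\gamma_j)_{j\ge1}$ be a non-increasing sequence of positive real weights, and set $$c_d^{\boldsymbol{\gamma}}:=\prod_{i=1}^d\left(1+\frac{\gamma_i}2\right)-\prod_{i=1}^d\left(1+\frac{\gamma_i}3\right).$$ Let the sequence $\mathcal{S}_d^{\boldsymbol{\gamma}}=\{\boldsymbol{x}_1,\boldsymbol{x}_2,\dots\}$ be generated as follows: (1) choose $\boldsymbol{x}_1\in[0,1]^d$ such that $L_{2,1}^{\boldsymbol{\gamma}}(\{\boldsymbol{x}_1\})^2\le c_d^{\boldsymbol{\gamma}}$; (2) for $N\ge1$, given $\boldsymbol{x}_1,\dots,\boldsymbol{x}_N$ with $\boldsymbol{x}_n=(x_{n,1},\dots,x_{n,d})$, choose $$\boldsymbol{x}_{N+1}\in\operatorname*{arg\,min}_{\boldsymbol{y}\in[0,1)^d}L_{2,N+1}^{\boldsymbol{\gamma}}(\{\boldsymbol{x}_1,\dots,\boldsymbol{x}_N,\boldsymbol{y}\})=\operatorname*{arg\,min}_{\boldsymbol{y}\in[0,1)^d}f_{N,d}^{\boldsymbol{\gamma}}(\boldsymbol{y}),$$ where $f_{N,d}^{\boldsymbol{\gamma}}:[0,1]^d\to\mathbb{R}$ is defined, for $\boldsymbol{y}=(y_1,\dots,y_d)$, by $$f_{N,d}^{\boldsymbol{\gamma}}(\boldsymbol{y})=-2(N+1)\prod_{i=1}^d\left(1+\frac{\gamma_i}2(1-y_i^2)\right)+2\sum_{n=1}^N\prod_{i=1}^d\left(1+\gamma_i(1-\max\{x_{n,i},y_i\})\right)+\prod_{i=1}^d\left(1+\gamma_i(1-y_i)\right).$$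 Then $L_{2,N}^{\boldsymbol{\gamma}}(\mathcal{S}_d^{\boldsymbol{\gamma}})^2\le c_d^{\boldsymbol{\gamma}}N$ for all $N\ge1$.
   Context: $\operatorname*{arg\,min}_{x\in M}f(x)$ denotes the set $\{x\in M: f(x)\le f(y)\text{ for all }y\in M\}$. For product weights given by $\boldsymbol{\gamma}=(\gamma_j)_{j\ge1}$, the weighted $L_2$ discrepancy $L_{2,N}^{\boldsymbol{\gamma}}(\mathcal{S})\ge0$ of the first $N$ elements of a (finite or infinite) sequence $\mathcal{S}=\{\boldsymbol{x}_1,\boldsymbol{x}_2,\dots\}$ in $[0,1]^d$, $\boldsymbol{x}_n=(x_{n,1},\dots,x_{n,d})$, is given explicitly by $$L_{2,N}^{\boldsymbol{\gamma}}(\mathcal{S})^2=N^2\prod_{i=1}^d\left(1+\frac{\gamma_i}3\right)-2N\sum_{n=1}^N\prod_{i=1}^d\left(1+\frac{\gamma_i}2(1-x_{n,i}^2)\right)+\sum_{n,m=1}^N\prod_{i=1}^d\left(1+\gamma_i(1-\max\{x_{n,i},x_{m,i}\})\right).$$ *)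

theory Defs
  imports "HOL-Analysis.Analysis"
begin

text \<open>
  Points of \<open>\<real>\<^sup>d\<close> are functions on the index set \<open>{1..d}\<close>, extensional outside it.
  A sequence \<open>x\<close> of points is indexed from 1, so \<open>x n i\<close> is the \<open>i\<close>-th coordinate of the
  \<open>n\<close>-th point; the value \<open>x 0\<close> and the weight \<open>\<gamma> 0\<close> are never used.
\<close>

definition closed_cube :: "nat \<Rightarrow> (nat \<Rightarrow> real) set" where
  "closed_cube d = {1..d} \<rightarrow>\<^sub>E {0..1}"

definition half_open_cube :: "nat \<Rightarrow> (nat \<Rightarrow> real) set" where
  "half_open_cube d = {1..d} \<rightarrow>\<^sub>E {0..<1}"

text \<open>The set of all minimisers, in contrast to the choice operators \<open>arg_min\<close> and \<open>arg_min_on\<close>.\<close>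

definition argmin_set :: "('a \<Rightarrow> real) \<Rightarrow> 'a set \<Rightarrow> 'a set" where
  "argmin_set f M = {x \<in> M. \<forall>y\<in>M. f x \<le> f y}"

text \<open>
  The weighted \<open>L\<^sub>2\<close> discrepancy, not normalised by \<open>N\<close>, of the first \<open>N\<close> points of \<open>x\<close> for
  the product weights \<open>\<gamma>\<close>, by Warnock's formula. The radicand is non-negative
  for points of the unit cube and positive weights.
\<close>

definition weighted_L2_disc :: "nat \<Rightarrow> (nat \<Rightarrow> real) \<Rightarrow> nat \<Rightarrow> (nat \<Rightarrow> nat \<Rightarrow> real) \<Rightarrow> real" where
  "weighted_L2_disc d \<gamma> N x = sqrt (
     (real N)\<^sup>2 * (\<Prod>i=1..d. 1 + \<gamma> i / 3)
     - 2 * real N * (\<Sum>n=1..N. \<Prod>i=1..d. 1 + \<gamma> i / 2 * (1 - (x n i)\<^sup>2))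
     + (\<Sum>n=1..N. \<Sum>m=1..N. \<Prod>i=1..d. 1 + \<gamma> i * (1 - max (x n i) (x m i))))"

definition disc_const :: "nat \<Rightarrow> (nat \<Rightarrow> real) \<Rightarrow> real" where
  "disc_const d \<gamma> = (\<Prod>i=1..d. 1 + \<gamma> i / 2) - (\<Prod>i=1..d. 1 + \<gamma> i / 3)"

definition greedy_objective ::
  "nat \<Rightarrow> (nat \<Rightarrow> real) \<Rightarrow> nat \<Rightarrow> (nat \<Rightarrow> nat \<Rightarrow> real) \<Rightarrow> (nat \<Rightarrow> real) \<Rightarrow> real" where
  "greedy_objective d \<gamma> N x y =
     - 2 * (real N + 1) * (\<Prod>i=1..d. 1 + \<gamma> i / 2 * (1 - (y i)\<^sup>2))
     + 2 * (\<Sum>n=1..N. \<Prod>i=1..d. 1 + \<gamma> i * (1 - max (x n i) (y i)))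
     + (\<Prod>i=1..d. 1 + \<gamma> i * (1 - y i))"

end

theory Submission
  imports Defs
begin

text \<open>
  Adding a point \<open>y\<close> raises the squared discrepancy by the objective plus a constant, and the
  Lebesgue mean of the objective over the cube makes this increment exactly \<open>disc_const\<close>.
  As a minimum is at most the mean, the bound follows by induction.

  Since \<open>(sqrt r)\<^sup>2 = \<bar>r\<bar>\<close>, non-negativity of the radicand is also needed. The kernel
  \<open>1 + c * (1 - max a b)\<close> is the inner product in \<open>L\<^sub>2(\<real>)\<close> of the functions \<open>feature c a\<close> and
  \<open>feature c b\<close>, and the other two factors of Warnock's formula are inner products with
  \<open>mean_feature c\<close>; hence the radicand is the squared norm of a function in \<open>L\<^sub>2(\<real>\<^sup>d)\<close>.
\<close>

text \<open>The radicand without the root: this quantity changes additively when a point is added,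
  so the induction runs on it.\<close>

definition warnock :: "nat \<Rightarrow> (nat \<Rightarrow> real) \<Rightarrow> nat \<Rightarrow> (nat \<Rightarrow> nat \<Rightarrow> real) \<Rightarrow> real" where
  "warnock d \<gamma> N x =
     (real N)\<^sup>2 * (\<Prod>i=1..d. 1 + \<gamma> i / 3)
     - 2 * real N * (\<Sum>n=1..N. \<Prod>i=1..d. 1 + \<gamma> i / 2 * (1 - (x n i)\<^sup>2))
     + (\<Sum>n=1..N. \<Sum>m=1..N. \<Prod>i=1..d. 1 + \<gamma> i * (1 - max (x n i) (x m i)))"

lemma weighted_L2_disc_eq: "weighted_L2_disc d \<gamma> N x = sqrt (warnock d \<gamma> N x)"
  by (simp add: weighted_L2_disc_def warnock_def)

text \<open>Fubini for products of one-variable functions. Integrability and value are kept in one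
  statement so that the explicit formulas below can be assembled by introduction rules.\<close>

lemma has_bochner_integral_PiM_prod:
  fixes f :: "'i \<Rightarrow> 'a \<Rightarrow> real"
  assumes "\<And>i. sigma_finite_measure (M i)" "finite I"
    and f: "\<And>i. i \<in> I \<Longrightarrow> has_bochner_integral (M i) (f i) (v i)"
  shows "has_bochner_integral (Pi\<^sub>M I M) (\<lambda>y. \<Prod>i\<in>I. f i (y i)) (\<Prod>i\<in>I. v i)"
proof -
  interpret product_sigma_finite M
    using assms(1) by (simp add: product_sigma_finite_def)
  show ?thesis
    using f product_integrable_prod[OF assms(2), of f] product_integral_prod[OF assms(2), of f]
    by (simp add: has_bochner_integral_iff)
qed

subsection \<open>Non-negativity\<close>

text \<open>The tail \<open>indicator {1<..2}\<close> has unit length and misses every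
  \<open>{a..1}\<close> with a \<le> 1, so in products it supplies the summand 1 of the kernel
  without cross terms.\<close>

definition feature :: "real \<Rightarrow> real \<Rightarrow> real \<Rightarrow> real" where
  "feature c a t = sqrt c * indicator {a..1} t + indicator {1<..2} t"

text \<open>The average of \<open>feature c a\<close> over a uniform in [0,1]: for t in [0,1], the
  set of such a with a \<le> t has length t.\<close>

definition mean_feature :: "real \<Rightarrow> real \<Rightarrow> real" where
  "mean_feature c t = sqrt c * t * indicator {0..1} t + indicator {1<..2} t"

text \<open>All three kinds of feature products reduce to this integral; k counts the factors
  \<open>mean_feature\<close>.\<close>

lemma has_bochner_integral_power_plus_tail:
  assumes "a \<le> 1"
  shows "has_bochner_integral lborel (\<lambda>t. c * (t ^ k * indicator {a..1} t) + indicator {1<..2} t)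
           (c * ((1 - a ^ Suc k) / Suc k) + 1 :: real)"
proof (intro has_bochner_integral_add has_bochner_integral_mult_right)
  have "has_bochner_integral lborel (\<lambda>t. indicator {a..1} t *\<^sub>R t ^ k)
          (1 ^ Suc k / Suc k - a ^ Suc k / Suc k :: real)"
  proof (rule has_bochner_integral_FTC_Icc[OF assms])
    show "((\<lambda>t. t ^ Suc k / Suc k) has_vector_derivative t ^ k) (at t within {a..1})" for t :: real
      by (auto intro!: derivative_eq_intros
          simp del: power_Suc of_nat_Suc simp flip: has_real_derivative_iff_has_vector_derivative)
  qed (intro continuous_intros)
  then show "has_bochner_integral lborel (\<lambda>t. t ^ k * indicator {a..1} t) ((1 - a ^ Suc k) / Suc k)"
    by (simp add: mult.commute diff_divide_distrib)
  show "has_bochner_integral lborel (indicator {1<..2::real}) (1 :: real)"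
    using has_bochner_integral_real_indicator[of "{1<..2::real}" lborel] by simp
qed

lemma has_bochner_integral_feature_mult_feature:
  assumes "a \<le> 1" "b \<le> 1" "c \<ge> 0"
  shows "has_bochner_integral lborel (\<lambda>t. feature c a t * feature c b t) (1 + c * (1 - max a b))"
proof -
  \<comment> \<open>The intervals \<open>{a..1}\<close> and \<open>{b..1}\<close> meet in
    \<open>{max a b..1}\<close>, which is where the maximum in the kernel comes from.\<close>
  have "(\<lambda>t. feature c a t * feature c b t)
      = (\<lambda>t. c * (t ^ 0 * indicator {max a b..1} t) + indicator {1<..2} t)"
    using assms by (auto simp: feature_def fun_eq_iff indicator_def)
  then show ?thesis
    using has_bochner_integral_power_plus_tail[of "max a b" c 0] assms by (simp add: add.commute)
qed

lemma has_bochner_integral_mean_feature_mult_feature: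
  assumes "0 \<le> a" "a \<le> 1" "c \<ge> 0"
  shows "has_bochner_integral lborel (\<lambda>t. mean_feature c t * feature c a t)
           (1 + c / 2 * (1 - a\<^sup>2))"
proof -
  have "(\<lambda>t. mean_feature c t * feature c a t)
      = (\<lambda>t. c * (t ^ 1 * indicator {a..1} t) + indicator {1<..2} t)"
    using assms by (auto simp: feature_def mean_feature_def fun_eq_iff indicator_def)
  then show ?thesis
    using has_bochner_integral_power_plus_tail[of a c 1] assms
    by (simp add: add.commute power2_eq_square)
qed

lemma has_bochner_integral_mean_feature_sq:
  assumes "c \<ge> 0"
  shows "has_bochner_integral lborel (\<lambda>t. mean_feature c t * mean_feature c t) (1 + c / 3)"
proof -
  have "(\<lambda>t. mean_feature c t * mean_feature c t)
      = (\<lambda>t. c * (t ^ 2 * indicator {0..1} t) + indicator {1<..2} t)"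
    using assms by (auto simp: mean_feature_def fun_eq_iff indicator_def power2_eq_square)
  then show ?thesis
    using has_bochner_integral_power_plus_tail[of 0 c 2] by (simp add: add.commute)
qed

lemma warnock_nonneg:
  assumes \<gamma>: "\<And>i. i \<in> {1..d} \<Longrightarrow> \<gamma> i \<ge> 0"
    and x: "\<And>n. n \<in> {1..N} \<Longrightarrow> x n \<in> closed_cube d"
  shows "warnock d \<gamma> N x \<ge> 0"
proof -
  define G where "G t = (\<Prod>i=1..d. mean_feature (\<gamma> i) (t i))" for t
  define F where "F n t = (\<Prod>i=1..d. feature (\<gamma> i) (x n i) (t i))" for n t
  let ?P = "Pi\<^sub>M {1..d} (\<lambda>_. lborel)"
  have xb: "0 \<le> x n i" "x n i \<le> 1" if "n \<in> {1..N}" "i \<in> {1..d}" for n i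
    using x[OF that(1)] that(2) by (auto simp: closed_cube_def PiE_iff)
  note prodI = has_bochner_integral_PiM_prod[OF lborel.sigma_finite_measure_axioms finite_atLeastAtMost]
  have GG: "has_bochner_integral ?P (\<lambda>t. G t * G t) (\<Prod>i=1..d. 1 + \<gamma> i / 3)"
    unfolding G_def prod.distrib[symmetric]
    by (rule prodI, rule has_bochner_integral_mean_feature_sq) (rule \<gamma>)
  have GF: "has_bochner_integral ?P (\<lambda>t. G t * F n t) (\<Prod>i=1..d. 1 + \<gamma> i / 2 * (1 - (x n i)\<^sup>2))"
    if "n \<in> {1..N}" for n
    unfolding G_def F_def prod.distrib[symmetric]
    by (rule prodI, rule has_bochner_integral_mean_feature_mult_feature) (use \<gamma> xb that in auto)
  have FF: "has_bochner_integral ?P (\<lambda>t. F n t * F m t)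
              (\<Prod>i=1..d. 1 + \<gamma> i * (1 - max (x n i) (x m i)))"
    if "n \<in> {1..N}" "m \<in> {1..N}" for n m
    unfolding F_def prod.distrib[symmetric]
    by (rule prodI, rule has_bochner_integral_feature_mult_feature) (use \<gamma> xb that in auto)
  \<comment> \<open>Warnock's formula is this expansion integrated term by term, with
    \<open>G\<close> and \<open>F n\<close> the tensor products of the one-dimensional
    features.\<close>
  have sq: "(real N * G t - (\<Sum>n=1..N. F n t))\<^sup>2
      = (real N)\<^sup>2 * (G t * G t) - 2 * real N * (\<Sum>n=1..N. G t * F n t)
        + (\<Sum>n=1..N. \<Sum>m=1..N. F n t * F m t)" for t
    unfolding power2_diff power2_eq_square[of "\<Sum>n=1..N. F n t"] sum_product
    by (simp add: power2_eq_square sum_distrib_left[symmetric])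
  have "has_bochner_integral ?P (\<lambda>t. (real N * G t - (\<Sum>n=1..N. F n t))\<^sup>2) (warnock d \<gamma> N x)"
    unfolding sq warnock_def
    by (intro has_bochner_integral_add has_bochner_integral_diff has_bochner_integral_mult_right
        has_bochner_integral_sum GG GF FF)
  then have "warnock d \<gamma> N x = (\<integral>t. (real N * G t - (\<Sum>n=1..N. F n t))\<^sup>2 \<partial>?P)"
    by (simp add: has_bochner_integral_iff)
  then show ?thesis
    by simp
qed

subsection \<open>The mean of the objective\<close>

text \<open>The endpoint 1 is a null set. The measure lives on \<open>{0..<1}\<close> because the
  minimisation is over the half-open cube.\<close>

lemma has_bochner_integral_unit_interval:
  fixes f :: "real \<Rightarrow> real"
  assumes "continuous_on {0..1} f" "(f has_integral I) {0..1}"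
  shows "has_bochner_integral (restrict_space lborel {0..<1}) f I"
proof -
  have int: "set_integrable lborel {0..1} f"
    using assms(1) by (rule borel_integrable_atLeastAtMost')
  then have int': "set_integrable lborel {0..<1} f"
    by (rule set_integrable_subset) auto
  have "(LINT t:{0..<1}|lborel. f t) = (LINT t:{0..1}|lborel. f t)"
    unfolding set_lebesgue_integral_def
  proof (rule integral_cong_AE)
    show "AE t in lborel. indicator {0..<1} t *\<^sub>R f t = indicator {0..1} t *\<^sub>R f t"
      using AE_lborel_singleton[of 1] by eventually_elim (auto simp: indicator_def)
  qed (use int int' in \<open>auto simp: set_integrable_def\<close>)
  also have "\<dots> = I"
    using set_borel_integral_eq_integral(2)[OF int] assms(2) by (simp add: integral_unique)
  finally show ?thesis
    using int'
    by (subst has_bochner_integral_restrict_space)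
      (simp_all add: has_bochner_integral_iff set_integrable_def set_lebesgue_integral_def)
qed

lemma has_integral_max:
  assumes "0 \<le> a" "a \<le> (1::real)"
  shows "((\<lambda>y. max a y) has_integral (1 + a\<^sup>2) / 2) {0..1}"
proof -
  have "((\<lambda>y. max a y) has_integral a * a) {0..a}"
    by (rule has_integral_eq[of _ "\<lambda>_. a"]) (use has_integral_const_real[of a 0 a] assms in auto)
  moreover have "((\<lambda>y. max a y) has_integral (1\<^sup>2 - a\<^sup>2) / 2) {a..1}"
    by (rule has_integral_eq[of _ "\<lambda>y. y"]) (use ident_has_integral[of a 1] assms in auto)
  ultimately have "((\<lambda>y. max a y) has_integral a * a + (1\<^sup>2 - a\<^sup>2) / 2) {0..1}"
    using assms by (blast intro: has_integral_combine)
  then show ?thesis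
    by (simp add: power2_eq_square field_simps)
qed

text \<open>The double sum gains a row, a column and a diagonal entry; by symmetry of the kernel the
  row and the column are equal. Everything that depends on \<open>y\<close> is collected in the
  objective.\<close>

lemma warnock_Suc:
  "warnock d \<gamma> (N + 1) (x(N + 1 := y)) = warnock d \<gamma> N x + greedy_objective d \<gamma> N x y
     + (2 * real N + 1) * (\<Prod>i=1..d. 1 + \<gamma> i / 3)
     - 2 * (\<Sum>n=1..N. \<Prod>i=1..d. 1 + \<gamma> i / 2 * (1 - (x n i)\<^sup>2))"
proof -
  define A where "A = (\<Prod>i=1..d. 1 + \<gamma> i / 3)"
  define h where "h z = (\<Prod>i=1..d. 1 + \<gamma> i / 2 * (1 - (z i)\<^sup>2))" for z
  define K where "K z w = (\<Prod>i=1..d. 1 + \<gamma> i * (1 - max (z i) (w i)))" for z w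
  have K_diag: "(\<Prod>i=1..d. 1 + \<gamma> i * (1 - y i)) = K y y"
    by (simp add: K_def)
  let ?z = "x(N + 1 := y)"
  have "(\<Sum>n=1..N. h (?z n)) = (\<Sum>n=1..N. h (x n))"
    and "(\<Sum>n=1..N. K (?z n) y) = (\<Sum>n=1..N. K (x n) y)"
    and "(\<Sum>n=1..N. \<Sum>m=1..N. K (?z n) (?z m)) = (\<Sum>n=1..N. \<Sum>m=1..N. K (x n) (x m))"
    and "(\<Sum>n=1..N. K y (?z n)) = (\<Sum>n=1..N. K (x n) y)"
    by (auto intro!: sum.cong simp: K_def max.commute)
  then show ?thesis
    unfolding warnock_def greedy_objective_def K_diag
    unfolding A_def[symmetric] h_def[symmetric] K_def[symmetric]
    by (simp add: sum.distrib power2_eq_square algebra_simps)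
qed

text \<open>A lower bound of a function is at most its mean over a probability space. The mean is
  computed coordinatewise from the one-dimensional integrals \<open>1\<close>, \<open>2\<close> and
  \<open>3\<close> in the proof.\<close>

lemma greedy_objective_min_le_mean:
  assumes x: "\<And>n. n \<in> {1..N} \<Longrightarrow> x n \<in> closed_cube d"
    and m: "\<And>y. y \<in> half_open_cube d \<Longrightarrow> m \<le> greedy_objective d \<gamma> N x y"
  shows "m \<le> - 2 * (real N + 1) * (\<Prod>i=1..d. 1 + \<gamma> i / 3)
     + 2 * (\<Sum>n=1..N. \<Prod>i=1..d. 1 + \<gamma> i / 2 * (1 - (x n i)\<^sup>2))
     + (\<Prod>i=1..d. 1 + \<gamma> i / 2)" (is "m \<le> ?mean")
proof -
  let ?U = "restrict_space lborel {0..<1::real}"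
  let ?P = "Pi\<^sub>M {1..d} (\<lambda>_. ?U)"
  have xb: "0 \<le> x n i" "x n i \<le> 1" if "n \<in> {1..N}" "i \<in> {1..d}" for n i
    using x[OF that(1)] that(2) by (auto simp: closed_cube_def PiE_iff)
  have "sigma_finite_measure ?U"
    by (intro sigma_finite_measure_restrict_space lborel.sigma_finite_measure_axioms) simp
  note prodI = has_bochner_integral_PiM_prod[OF this finite_atLeastAtMost]
  have const: "((\<lambda>y. c) has_integral c) {0..1::real}" for c :: real
    using has_integral_const_real[of c 0 1] by simp
  have id: "((\<lambda>y. y) has_integral 1 / 2) {0..1::real}"
    using ident_has_integral[of 0 1] by simp
  have sq: "((\<lambda>y. y\<^sup>2) has_integral 1 / 3) {0..1::real}"
  proof -
    have "((\<lambda>y. y\<^sup>2) has_integral 1 ^ 3 / 3 - 0 ^ 3 / 3) {0..1::real}"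
      by (rule fundamental_theorem_of_calculus)
        (auto intro!: derivative_eq_intros
          simp flip: has_real_derivative_iff_has_vector_derivative)
    then show ?thesis
      by simp
  qed
  have 1: "has_bochner_integral ?U (\<lambda>y. 1 + c / 2 * (1 - y\<^sup>2)) (1 + c / 3)" for c
    using has_integral_add[OF const has_integral_mult_right[OF has_integral_diff[OF const sq]],
        of 1 "c / 2" 1]
    by (intro has_bochner_integral_unit_interval continuous_intros) simp
  have 2: "has_bochner_integral ?U (\<lambda>y. 1 + c * (1 - max a y)) (1 + c / 2 * (1 - a\<^sup>2))"
    if "0 \<le> a" "a \<le> 1" for a c
    using has_integral_add[OF const
        has_integral_mult_right[OF has_integral_diff[OF const has_integral_max[OF that]]], of 1 c 1]
    by (intro has_bochner_integral_unit_interval continuous_intros) (simp add: field_simps)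
  have 3: "has_bochner_integral ?U (\<lambda>y. 1 + c * (1 - y)) (1 + c / 2)" for c
    using has_integral_add[OF const has_integral_mult_right[OF has_integral_diff[OF const id]],
        of 1 c 1]
    by (intro has_bochner_integral_unit_interval continuous_intros) simp
  have 4: "has_bochner_integral ?U (\<lambda>y. 1) (1 :: real)"
    by (intro has_bochner_integral_unit_interval continuous_intros const)
  \<comment> \<open>Writing the constant as \<open>m\<close> times a product of ones lets
    \<open>prodI\<close> show that the product measure has total mass 1.\<close>
  have "has_bochner_integral ?P (\<lambda>y. m * (\<Prod>i=1..d. 1)) (m * (\<Prod>i=1..d. 1))"
    by (intro has_bochner_integral_mult_right prodI 4)
  then have 0: "integrable ?P (\<lambda>y. m)" "m = (\<integral>y. m \<partial>?P)"
    unfolding prod.neutral_const mult_1_right by (metis has_bochner_integral_iff)+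
  have obj: "has_bochner_integral ?P (greedy_objective d \<gamma> N x) ?mean"
    unfolding greedy_objective_def
    by (intro has_bochner_integral_add has_bochner_integral_mult_right has_bochner_integral_sum
        prodI 1 2 3 xb)
  \<comment> \<open>The bound \<open>m\<close> is known only on the half-open cube, which is the
    whole space here, so the integrals can be compared pointwise.\<close>
  have "space ?P = half_open_cube d"
    by (simp add: space_PiM half_open_cube_def space_restrict_space)
  then have "(\<integral>y. m \<partial>?P) \<le> (\<integral>y. greedy_objective d \<gamma> N x y \<partial>?P)"
    using obj by (intro integral_mono 0 m) (simp_all add: has_bochner_integral_iff)
  then show ?thesis
    unfolding 0(2)[symmetric] has_bochner_integral_integral_eq[OF obj] .
qed

theorem theorem5:
  fixes d :: nat and \<gamma> :: "nat \<Rightarrow> real" and x :: "nat \<Rightarrow> nat \<Rightarrow> real"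
  assumes "d \<ge> 1"
    and "\<And>j. j \<ge> 1 \<Longrightarrow> \<gamma> j > 0"
    and "\<And>i j. 1 \<le> i \<Longrightarrow> i \<le> j \<Longrightarrow> \<gamma> j \<le> \<gamma> i"
    and "x 1 \<in> closed_cube d"
    and "(weighted_L2_disc d \<gamma> 1 x)\<^sup>2 \<le> disc_const d \<gamma>"
    and "\<And>N. N \<ge> 1 \<Longrightarrow>
           x (N + 1) \<in> argmin_set (\<lambda>y. weighted_L2_disc d \<gamma> (N + 1) (x(N + 1 := y)))
                                  (half_open_cube d)"
  shows "\<forall>N\<ge>1.
           argmin_set (\<lambda>y. weighted_L2_disc d \<gamma> (N + 1) (x(N + 1 := y))) (half_open_cube d)
             = argmin_set (greedy_objective d \<gamma> N x) (half_open_cube d)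
         \<and> (weighted_L2_disc d \<gamma> N x)\<^sup>2 \<le> disc_const d \<gamma> * real N"
proof -
  have pos: "\<gamma> i \<ge> 0" if "i \<in> {1..d}" for i
    using assms(2)[of i] that by simp
  have half_le_closed: "half_open_cube d \<subseteq> closed_cube d"
    by (auto simp: half_open_cube_def closed_cube_def PiE_iff less_imp_le)
  have cube: "x n \<in> closed_cube d" if "n \<in> {1..N}" for n N
  \<comment> \<open>Only the first point may have a coordinate equal to 1; later points are
    minimisers in the half-open cube.\<close>
  proof (cases "n = 1")
    case False
    with that obtain k where "n = k + 1" "k \<ge> 1"
      by (cases n) auto
    then show ?thesis
      using assms(6)[of k] half_le_closed by (auto simp: argmin_set_def)
  qed (use assms(4) in simp)
  \<comment> \<open>\<open>sqrt\<close> is strictly increasing on the whole real line, and the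
    radicand differs from the objective by a term independent of \<open>y\<close>.\<close>
  have argmin: "argmin_set (\<lambda>y. weighted_L2_disc d \<gamma> (N + 1) (x(N + 1 := y))) M
      = argmin_set (greedy_objective d \<gamma> N x) M" for N M
    unfolding weighted_L2_disc_eq warnock_Suc argmin_set_def by simp
  have disc_sq: "(weighted_L2_disc d \<gamma> N x)\<^sup>2 = warnock d \<gamma> N x" for N
    using warnock_nonneg[OF pos cube] by (simp add: weighted_L2_disc_eq)
  have "warnock d \<gamma> N x \<le> disc_const d \<gamma> * real N" if "N \<ge> 1" for N
    using that
  proof (induction N rule: dec_induct)
    case base
    then show ?case
      using assms(5) disc_sq by simp
  next
    case (step N)
    have "x (N + 1) \<in> argmin_set (greedy_objective d \<gamma> N x) (half_open_cube d)"
      using assms(6)[of N] step.hyps argmin by simp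
    then have "greedy_objective d \<gamma> N x (x (N + 1))
        \<le> - 2 * (real N + 1) * (\<Prod>i=1..d. 1 + \<gamma> i / 3)
          + 2 * (\<Sum>n=1..N. \<Prod>i=1..d. 1 + \<gamma> i / 2 * (1 - (x n i)\<^sup>2))
          + (\<Prod>i=1..d. 1 + \<gamma> i / 2)"
      by (intro greedy_objective_min_le_mean cube) (auto simp: argmin_set_def)
    \<comment> \<open>Updating \<open>x\<close> at N + 1 with its own value changes nothing. The
      sums over the old points cancel, and the product of the 1 + \<gamma> i / 3 keeps the
      coefficient (2N + 1) - 2(N + 1) = -1, which leaves
      \<open>disc_const d \<gamma>\<close>.\<close>
    then have "warnock d \<gamma> (N + 1) x \<le> warnock d \<gamma> N x + disc_const d \<gamma>"
      using warnock_Suc[of d \<gamma> N x "x (N + 1)"] by (simp add: disc_const_def algebra_simps)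
    then show ?case
      using step.IH by (simp add: algebra_simps)
  qed
  then show ?thesis
    using argmin disc_sq by simp
qed

end
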